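(* Let $k,\ell$ be positive integers with $1 \leq \ell \leq \binom{k}{2}$, and suppose an optimal $(2k(k-1) + 2\ell,k,1)$-optical orthogonal code exists. Define the set $R$ as follows (with $h$ ranging over integers): $$ R = \begin{cases} \left\{ \left\lfloor \frac{k-\ell+1}{2} \right\rfloor + h \ : \ 0 \leq h \leq \ell -1 \right\} & \text{if $k$ is even}\\ \left\{ k-\ell+2h \ : \ 0 \leq h \leq \ell -1 \right\} & \text{if $k$ is odd and $\ell$ is even}\\ \left\{ k-\ell+2h+1 \ : \ 0 \leq h \leq \ell -1 \right\} & \text{if $k$ and $\ell$ are both odd.} \end{cases}$$ Then at least one integer in the set $R$ can be expressed as the sum of two squares.
   Context: A $(v,k,1)$-optical orthogonal code ($(v,k,1)$-OOC) of size $n$ is a set $\mathcal{C}$ of $n$ $(0,1)$-vectors of length $v$, each of Hamming weight $k$, such that (with subscripts reduced modulo $v$): for every $\mathbf{x}=(x_0,\dots,x_{v-1}) \in \mathcal{C}$ and every integer $0<\tau<v$, $\sum_{i=0}^{v-1} x_i x_{i+\tau} \le 1$; and for all $\mathbf{x}\ne\mathbf{y}$ in $\mathcal{C}$ and every integer $0\le\tau<v$, $\sum_{i=0}^{v-1} x_i y_{i+\tau} \le 1$. The size of a $(v,k,1)$-OOC is always at most $\left\lfloor \frac{v-1}{k(k-1)} \right\rfloor$; it is called optimal if its size equals $\left\lfloor \frac{v-1}{k(k-1)} \right\rfloor$. Squares are squares of integers ($0$ allowed). *)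

theory Defs
  imports Main
begin

definition is_OOC :: "nat \<Rightarrow> nat \<Rightarrow> nat list set \<Rightarrow> bool" where
  "is_OOC v k C \<longleftrightarrow>
     (\<forall>x\<in>C. length x = v \<and> set x \<subseteq> {0, 1} \<and> card {i. i < v \<and> x ! i \<noteq> 0} = k) \<and>
     (\<forall>x\<in>C. \<forall>\<tau>. 0 < \<tau> \<and> \<tau> < v \<longrightarrow>
        (\<Sum>i<v. x ! i * x ! ((i + \<tau>) mod v)) \<le> 1) \<and>
     (\<forall>x\<in>C. \<forall>y\<in>C. x \<noteq> y \<longrightarrow> (\<forall>\<tau><v.
        (\<Sum>i<v. x ! i * y ! ((i + \<tau>) mod v)) \<le> 1))"

text \<open>The size bound is the floor of a quotient of natural numbers, so \<open>div\<close> is used; the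
  notion is only meaningful for \<open>v \<ge> 1\<close> and \<open>k \<ge> 2\<close>.\<close>
definition is_optimal_OOC :: "nat \<Rightarrow> nat \<Rightarrow> nat list set \<Rightarrow> bool" where
  "is_optimal_OOC v k C \<longleftrightarrow> is_OOC v k C \<and> card C = (v - 1) div (k * (k - 1))"

text \<open>Elements of \<open>R\<close> may be negative, as \<open>\<ell>\<close> may exceed \<open>k\<close>; hence integers throughout.
  Integer \<open>div\<close> rounds towards minus infinity, so \<open>div 2\<close> is the floor of the half.\<close>
definition R_set :: "nat \<Rightarrow> nat \<Rightarrow> int set" where
  "R_set k l =
     (if even k then {(int k - int l + 1) div 2 + h | h. 0 \<le> h \<and> h \<le> int l - 1}
      else if even l then {int k - int l + 2 * h | h. 0 \<le> h \<and> h \<le> int l - 1}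
      else {int k - int l + 2 * h + 1 | h. 0 \<le> h \<and> h \<le> int l - 1})"

end

theory Submission
  imports Defs
begin

text \<open>Identify a codeword with its support in \<open>\<int>\<^sub>v\<close>. The correlation conditions say that all
  differences of distinct elements of a common support, over all codewords, are distinct
  (\<open>inj_on_cyc_diff\<close>). For \<open>v = 2 * k * (k - 1) + 2 * l\<close> with \<open>1 \<le> l \<le> k choose 2\<close>, optimality means
  that there are exactly two codewords, whose \<open>2 * k * (k - 1)\<close> differences miss exactly
  \<open>2 * l - 1\<close> of the nonzero residues.

  Now count odd differences; parity is well defined because \<open>v\<close> is even. If the supports contain
  \<open>a\<close> and \<open>b\<close> odd elements, there are \<open>2 * a * (k - a) + 2 * b * (k - b)\<close> odd differences, out of
  \<open>v div 2 = k * (k - 1) + l\<close> odd residues. So the number \<open>m\<close> of missed odd residues satisfies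
  \<open>0 \<le> m \<le> 2 * l - 1\<close> and \<open>k - l + m = (k - a - b)\<^sup>2 + (a - b)\<^sup>2\<close>. If \<open>k\<close> is odd, this sum of two
  squares is odd, which fixes the parity of \<open>m\<close>, and it lies in \<open>R\<close>. If \<open>k\<close> is even, it equals
  \<open>2 * ((k div 2 - a)\<^sup>2 + (k div 2 - b)\<^sup>2)\<close>, and its half lies in \<open>R\<close>.\<close>

section \<open>Cyclic differences in the supports of codewords\<close>

text \<open>The support of a word, as a set of positions.\<close>
definition supp :: "nat list \<Rightarrow> nat set" where
  "supp x = {i. i < length x \<and> x ! i \<noteq> 0}"

text \<open>The difference \<open>j - i\<close> modulo \<open>v\<close>, as a representative in \<open>{0..<v}\<close>. It is meant for
  \<open>i, j < v\<close>, so that the subtraction of naturals does not truncate.\<close>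
definition cyc_diff :: "nat \<Rightarrow> nat \<Rightarrow> nat \<Rightarrow> nat" where
  "cyc_diff v i j = (j + (v - i)) mod v"

text \<open>Ordered pairs of distinct elements of the support of a codeword, tagged with the codeword.\<close>
definition diff_pairs :: "nat list set \<Rightarrow> (nat list \<times> nat \<times> nat) set" where
  "diff_pairs C = (SIGMA x:C. {(i, j) \<in> supp x \<times> supp x. i \<noteq> j})"

lemma finite_supp [simp]: "finite (supp x)"
  by (simp add: supp_def)

lemma cyc_diff_less: "v > 0 \<Longrightarrow> cyc_diff v i j < v"
  by (simp add: cyc_diff_def)

lemma add_cyc_diff:
  assumes "i < v" "j < v"
  shows "(i + cyc_diff v i j) mod v = j"
proof -
  have "(i + cyc_diff v i j) mod v = (i + (j + (v - i))) mod v"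
    unfolding cyc_diff_def by (rule mod_add_right_eq)
  also have "i + (j + (v - i)) = j + v" using assms by simp
  finally show ?thesis using assms by simp
qed

lemma cyc_diff_pos:
  assumes "i < v" "j < v" "i \<noteq> j"
  shows "0 < cyc_diff v i j"
  using add_cyc_diff[OF assms(1,2)] assms by (cases "cyc_diff v i j") auto

lemma odd_cyc_diff_iff:
  assumes "even v" "i < v"
  shows "odd (cyc_diff v i j) \<longleftrightarrow> odd i \<noteq> odd j"
  using assms by (auto simp: cyc_diff_def dvd_mod_iff)

text \<open>If two different positions contribute to a correlation, it exceeds 1.\<close>
lemma correlation_positions_eq:
  fixes f :: "nat \<Rightarrow> nat"
  assumes "(\<Sum>i<v. f i) \<le> 1" "i < v" "j < v" "f i \<noteq> 0" "f j \<noteq> 0"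
  shows "i = j"
proof (rule ccontr)
  assume "i \<noteq> j"
  then have "f i + f j = (\<Sum>i\<in>{i, j}. f i)" by simp
  also have "\<dots> \<le> (\<Sum>i<v. f i)" using assms by (intro sum_mono2) auto
  finally show False using assms by linarith
qed

lemma inj_on_cyc_diff:
  assumes ooc: "is_OOC v k C"
  shows "inj_on (\<lambda>(x, i, j). cyc_diff v i j) (diff_pairs C)"
proof (rule inj_onI, clarsimp)
  fix x i j y i' j'
  assume p: "(x, i, j) \<in> diff_pairs C" and q: "(y, i', j') \<in> diff_pairs C"
    and eq: "cyc_diff v i j = cyc_diff v i' j'"
  have len: "length z = v" if "z \<in> C" for z
    using ooc that by (simp add: is_OOC_def)
  have x: "x \<in> C" "i < v" "j < v" "i \<noteq> j" "x ! i \<noteq> 0" "x ! j \<noteq> 0"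
    using p len by (auto simp: diff_pairs_def supp_def)
  have y: "y \<in> C" "i' < v" "j' < v" "i' \<noteq> j'" "y ! i' \<noteq> 0" "y ! j' \<noteq> 0"
    using q len by (auto simp: diff_pairs_def supp_def)
  define t where "t = cyc_diff v i j"
  have t: "0 < t" "t < v" "(i + t) mod v = j"
    using x cyc_diff_pos[of i v j] cyc_diff_less[of v i j] add_cyc_diff[of i v j]
    by (simp_all add: t_def)
  have t': "(i' + t) mod v = j'"
    using y add_cyc_diff[of i' v j'] by (simp add: t_def eq)
  show "x = y \<and> i = i' \<and> j = j'"
  proof (cases "x = y")
    case True
    have "(\<Sum>i<v. x ! i * x ! ((i + t) mod v)) \<le> 1"
      using ooc x t by (simp add: is_OOC_def)
    then have "i = i'"
      by (rule correlation_positions_eq) (simp_all add: x y[folded True] t t')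
    then show ?thesis using t t' True by simp
  next
    case False
    \<comment> \<open>Shifting by \<open>i' - i = j' - j\<close> aligns both positions \<open>i, j\<close> of \<open>x\<close> with positions of \<open>y\<close>.\<close>
    define s where "s = cyc_diff v i i'"
    have s: "s < v" "(i + s) mod v = i'"
      using x y cyc_diff_less[of v i i'] add_cyc_diff[of i v i'] by (simp_all add: s_def)
    have "(j + s) mod v = (i + t + s) mod v"
      using t(3) by (metis mod_add_left_eq)
    also have "\<dots> = (i' + t) mod v"
      using s(2) by (metis add.assoc add.commute mod_add_left_eq)
    finally have js: "(j + s) mod v = j'" using t' by simp
    have "(\<Sum>i<v. x ! i * y ! ((i + s) mod v)) \<le> 1"
      using ooc x y s False by (simp add: is_OOC_def)
    then have "i = j"
      by (rule correlation_positions_eq) (simp_all add: x y s js)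
    then show ?thesis using x by simp
  qed
qed

section \<open>Counting differences by parity\<close>

lemma finite_pairs:
  assumes "finite S"
  shows "finite {(i, j) \<in> S \<times> S. P i j}"
  by (rule finite_subset[of _ "S \<times> S"]) (use assms in auto)

lemma card_distinct_pairs:
  assumes "finite S"
  shows "card {(i, j) \<in> S \<times> S. i \<noteq> j} = card S * (card S - 1)"
proof -
  have "{(i, j) \<in> S \<times> S. i \<noteq> j} = (SIGMA i:S. S - {i})" by auto
  then show ?thesis using assms by simp
qed

lemma card_odd_pairs:
  fixes S :: "nat set"
  assumes "finite S"
  shows "card {(i, j) \<in> S \<times> S. odd i \<noteq> odd j} =
    2 * card {i\<in>S. odd i} * (card S - card {i\<in>S. odd i})"
proof -
  let ?O = "{i\<in>S. odd i}"
  have card_compl: "card (S - ?O) = card S - card ?O"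
    by (rule card_Diff_subset) (use assms in auto)
  have split: "{(i, j) \<in> S \<times> S. odd i \<noteq> odd j} = ?O \<times> (S - ?O) \<union> (S - ?O) \<times> ?O"
    by auto
  have "card (?O \<times> (S - ?O) \<union> (S - ?O) \<times> ?O) = card (?O \<times> (S - ?O)) + card ((S - ?O) \<times> ?O)"
    using assms by (intro card_Un_disjoint) auto
  then show ?thesis
    unfolding split card_cartesian_product card_compl by simp
qed

lemma card_odd_lessThan: "card {d. d < 2 * n \<and> odd d} = n"
proof -
  have "{d. d < 2 * n \<and> odd d} = (\<lambda>i. 2 * i + 1) ` {..<n}"
    by (auto elim!: oddE)
  then show ?thesis by (simp add: card_image inj_on_def)
qed

lemma card_even_pos_lessThan: "card {d. 0 < d \<and> d < 2 * n \<and> even d} = n - 1"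
proof -
  have "{d. 0 < d \<and> d < 2 * n \<and> even d} = (\<lambda>i. 2 * i) ` {0<..<n}"
    by (auto elim!: evenE)
  then show ?thesis by (simp add: card_image inj_on_def)
qed

text \<open>The differences of a code, counted by parity, fit among the \<open>n\<close> odd and the \<open>n - 1\<close> nonzero
  even residues modulo \<open>2 * n\<close>.\<close>
lemma OOC_parity_bounds:
  fixes C :: "nat list set"
  assumes ooc: "is_OOC (2 * n) k C" and fin: "finite C"
  defines "a \<equiv> \<lambda>x. card {i \<in> supp x. odd i}"
  shows "(\<Sum>x\<in>C. 2 * a x * (k - a x)) \<le> n"
    and "card C * (k * (k - 1)) \<le> (\<Sum>x\<in>C. 2 * a x * (k - a x)) + (n - 1)"
proof -
  let ?D = "\<lambda>(x :: nat list, i, j). cyc_diff (2 * n) i j"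
  let ?P = "diff_pairs C"
  define Q where "Q = {(x, i, j) \<in> ?P. odd i \<noteq> odd j}"
  have supp_card: "card (supp x) = k" and supp_less: "\<And>i. i \<in> supp x \<Longrightarrow> i < 2 * n"
    if "x \<in> C" for x
    using ooc that by (auto simp: is_OOC_def supp_def)
  have finP: "finite ?P"
    unfolding diff_pairs_def by (intro finite_SigmaI fin finite_pairs finite_supp)
  have QP: "Q \<subseteq> ?P" by (auto simp: Q_def)
  have inj: "inj_on ?D ?P" by (rule inj_on_cyc_diff[OF ooc])
  have cardP: "card ?P = card C * (k * (k - 1))"
  proof -
    have "card ?P = (\<Sum>x\<in>C. card {(i, j) \<in> supp x \<times> supp x. i \<noteq> j})"
      unfolding diff_pairs_def by (intro card_SigmaI ballI fin finite_pairs finite_supp)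
    also have "\<dots> = (\<Sum>x\<in>C. k * (k - 1))"
      by (intro sum.cong refl) (simp only: card_distinct_pairs finite_supp supp_card)
    finally show ?thesis by simp
  qed
  have cardQ: "card Q = (\<Sum>x\<in>C. 2 * a x * (k - a x))"
  proof -
    have "Q = (SIGMA x:C. {(i, j) \<in> supp x \<times> supp x. odd i \<noteq> odd j})"
      by (auto simp: Q_def diff_pairs_def)
    also have "card \<dots> = (\<Sum>x\<in>C. card {(i, j) \<in> supp x \<times> supp x. odd i \<noteq> odd j})"
      by (intro card_SigmaI ballI fin finite_pairs finite_supp)
    also have "\<dots> = (\<Sum>x\<in>C. 2 * a x * (k - a x))"
      by (intro sum.cong refl) (simp only: card_odd_pairs finite_supp supp_card a_def)
    finally show ?thesis .
  qed
  have "card Q = card (?D ` Q)"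
    using inj QP by (metis card_image inj_on_subset)
  also have "\<dots> \<le> card {d. d < 2 * n \<and> odd d}"
  proof (rule card_mono)
    show "?D ` Q \<subseteq> {d. d < 2 * n \<and> odd d}"
    proof clarify
      fix x i j
      assume "(x, i, j) \<in> Q"
      then have "i < 2 * n" "odd i \<noteq> odd j"
        using supp_less by (auto simp: Q_def diff_pairs_def)
      then show "cyc_diff (2 * n) i j < 2 * n \<and> odd (cyc_diff (2 * n) i j)"
        using cyc_diff_less odd_cyc_diff_iff[of "2 * n" i j] by auto
    qed
  qed simp
  finally show "(\<Sum>x\<in>C. 2 * a x * (k - a x)) \<le> n"
    by (simp add: cardQ card_odd_lessThan)
  have "card (?P - Q) = card (?D ` (?P - Q))"
    using inj by (metis card_image inj_on_diff)
  also have "\<dots> \<le> card {d. 0 < d \<and> d < 2 * n \<and> even d}"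
  proof (rule card_mono)
    show "?D ` (?P - Q) \<subseteq> {d. 0 < d \<and> d < 2 * n \<and> even d}"
    proof clarify
      fix x i j
      assume "(x, i, j) \<in> ?P" "(x, i, j) \<notin> Q"
      then have ij: "i < 2 * n" "j < 2 * n" "i \<noteq> j" "odd i = odd j"
        using supp_less by (auto simp: Q_def diff_pairs_def)
      then show "0 < cyc_diff (2 * n) i j \<and> cyc_diff (2 * n) i j < 2 * n \<and>
          even (cyc_diff (2 * n) i j)"
        using cyc_diff_pos cyc_diff_less odd_cyc_diff_iff[of "2 * n" i j] by auto
    qed
  qed simp
  finally have "card (?P - Q) \<le> n - 1"
    by (simp add: card_even_pos_lessThan)
  moreover have "card ?P = card Q + card (?P - Q)"
    using finP QP by (metis card_Diff_subset card_mono finite_subset le_add_diff_inverse)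
  ultimately show "card C * (k * (k - 1)) \<le> (\<Sum>x\<in>C. 2 * a x * (k - a x)) + (n - 1)"
    using cardP cardQ by linarith
qed

section \<open>Representation by two squares\<close>

text \<open>Here \<open>m\<close> is the number of odd residues that are not differences, and \<open>a\<close>, \<open>b\<close> are the numbers of
  odd elements in the two supports.\<close>
lemma R_set_sum_two_squares:
  fixes k l :: nat and a b m :: int
  assumes m: "0 \<le> m" "m \<le> 2 * int l - 1"
    and eq: "2 * a * (int k - a) + 2 * b * (int k - b) + m = int k * (int k - 1) + int l"
  shows "\<exists>r\<in>R_set k l. \<exists>c d :: int. r = c\<^sup>2 + d\<^sup>2"
proof -
  have sq: "int k - int l + m = (int k - a - b)\<^sup>2 + (a - b)\<^sup>2"
    using eq by (simp add: power2_eq_square algebra_simps)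
  show ?thesis
  proof (cases "even k")
    case True
    then obtain c where c: "int k = 2 * c" by (metis evenE even_of_nat)
    define r where "r = (c - a)\<^sup>2 + (c - b)\<^sup>2"
    have r: "int k - int l + m = 2 * r"
      using sq unfolding c r_def by (simp add: power2_eq_square algebra_simps)
    define h where "h = r - (int k - int l + 1) div 2"
    have "0 \<le> h" using r m unfolding h_def by linarith
    moreover have "h \<le> int l - 1" using r m unfolding h_def by linarith
    moreover have "r = (int k - int l + 1) div 2 + h" by (simp add: h_def)
    ultimately have "r \<in> R_set k l" using True unfolding R_set_def by auto
    then show ?thesis unfolding r_def by blast
  next
    case False
    have "odd (int k - int l + m)"
      unfolding sq using False by (cases "even a"; cases "even b") simp_all
    then have par: "even m \<longleftrightarrow> even l" using False by auto
    have "int k - int l + m \<in> R_set k l"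
    proof (cases "even l")
      case True
      then obtain h where "m = 2 * h" using par by (metis evenE)
      then show ?thesis using m False True
        by (auto simp: R_set_def intro!: exI[of _ h])
    next
      case odd_l: False
      then obtain h where "m = 2 * h + 1" using par by (metis oddE)
      then show ?thesis using m False odd_l
        by (auto simp: R_set_def intro!: exI[of _ h])
    qed
    then show ?thesis using sq by blast
  qed
qed

lemma card_optimal_OOC:
  assumes "1 \<le> l" "l \<le> k choose 2" and opt: "is_optimal_OOC (2 * k * (k - 1) + 2 * l) k C"
  shows "card C = 2"
proof -
  have "2 * l \<le> k * (k - 1)"
    using assms(2) unfolding choose_two by linarith
  then have "2 * k * (k - 1) + 2 * l - 1 = (2 * l - 1) + 2 * (k * (k - 1))"
    and "2 * l - 1 < k * (k - 1)"
    using assms(1) by (simp_all add: mult.assoc)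
  moreover have "(r + 2 * d) div d = 2" if "r < d" for r d :: nat
    using that by simp
  ultimately have "(2 * k * (k - 1) + 2 * l - 1) div (k * (k - 1)) = 2"
    by presburger
  then show ?thesis using opt by (simp add: is_optimal_OOC_def)
qed

theorem theorem4p7:
  fixes k l :: nat
  assumes "1 \<le> k" and "1 \<le> l" and "l \<le> k choose 2"
    and "\<exists>C. is_optimal_OOC (2 * k * (k - 1) + 2 * l) k C"
  shows "\<exists>r\<in>R_set k l. \<exists>a b :: int. r = a\<^sup>2 + b\<^sup>2"
proof -
  obtain C where opt: "is_optimal_OOC (2 * k * (k - 1) + 2 * l) k C"
    using assms(4) by blast
  define n where "n = k * (k - 1) + l"
  have ooc: "is_OOC (2 * n) k C"
    using opt by (simp add: is_optimal_OOC_def n_def distrib_left mult.assoc)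
  have two: "card C = 2"
    using card_optimal_OOC[OF assms(2,3) opt] .
  then have fin: "finite C" using card.infinite by fastforce
  obtain x y where xy: "C = {x, y}" "x \<noteq> y"
    using two by (auto simp: card_2_iff)
  define a where "a = (\<lambda>x. card {i \<in> supp x. odd i})"
  have a_le: "a z \<le> k" if "z \<in> C" for z
  proof -
    have "a z \<le> card (supp z)" unfolding a_def by (intro card_mono) auto
    also have "\<dots> = k" using ooc that by (auto simp: is_OOC_def supp_def)
    finally show ?thesis .
  qed
  define T where "T = 2 * a x * (k - a x) + 2 * a y * (k - a y)"
  have sumT: "(\<Sum>z\<in>C. 2 * a z * (k - a z)) = T" using xy by (simp add: T_def)
  have T: "T \<le> n" "2 * (k * (k - 1)) \<le> T + (n - 1)"
    using OOC_parity_bounds[OF ooc fin] sumT two unfolding a_def by simp_all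
  have T_int: "int T = 2 * int (a x) * (int k - int (a x)) + 2 * int (a y) * (int k - int (a y))"
    using a_le xy by (simp add: T_def of_nat_diff)
  have n_int: "int n = int k * (int k - 1) + int l"
    using assms(1) by (simp add: n_def of_nat_diff)
  show ?thesis
  proof (rule R_set_sum_two_squares)
    show "0 \<le> int n - int T" using T by simp
    show "int n - int T \<le> 2 * int l - 1"
      using T(2) assms(2) unfolding n_def by linarith
    show "2 * int (a x) * (int k - int (a x)) + 2 * int (a y) * (int k - int (a y))
        + (int n - int T) = int k * (int k - 1) + int l"
      using T_int n_int by simp
  qed
qed

end
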